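(* Let $A$ be a countable-dimensional locally matrix algebra over a field $\mathbb{F}$. Then $$|\mathrm{Aut}(A)|=|\mathrm{Out}(A)|=|\mathbb{F}|^{\aleph_0}.$$
   Context: An associative $\mathbb{F}$-algebra $A$ (not necessarily with unit) is a locally matrix algebra if every finite subset of $A$ is contained in a subalgebra $B\subset A$ with $B\cong M_n(\mathbb{F})$ for some $n$. Countable-dimensional means of dimension $\aleph_0$ over $\mathbb{F}$. $\mathrm{Aut}(A)$ is the group of $\mathbb{F}$-algebra automorphisms of $A$, $\mathrm{Inn}(A)$ is the normal subgroup of inner automorphisms, i.e. conjugations $x\mapsto a^{-1}xa$ by invertible elements $a$ of $A$ if $A$ is unital, and of the algebra $A+\mathbb{F}\cdot1$ obtained by adjoining a unit if $A$ is not unital; $\mathrm{Out}(A)=\mathrm{Aut}(A)/\mathrm{Inn}(A)$. $|X|$ denotes the cardinality of a set $X$, $\aleph_0$ is the countable cardinality, and $|X|^{|Y|}$ is the cardinality of the set of all maps $Y\to X$. *)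

theory Defs
  imports "Jordan_Normal_Form.Matrix" "HOL-Algebra.Coset"
begin

unbundle cardinal_syntax

text \<open>
  An associative algebra, not necessarily with unit, over the field \<open>'f\<close>: the ring \<open>'a\<close>
  (class \<open>ring\<close> does not require a unit) with a scalar multiplication. The algebra is the whole
  type \<open>'a\<close>.
\<close>

locale nonunital_algebra = vector_space scale
  for scale :: "'f::field \<Rightarrow> 'a::ring \<Rightarrow> 'a" (infixr \<open>*s\<close> 75) +
  assumes scale_mult_left: "(c *s x) * y = c *s (x * y)"
    and scale_mult_right: "x * (c *s y) = c *s (x * y)"
begin

definition is_subalgebra :: "'a set \<Rightarrow> bool" where
  "is_subalgebra B \<longleftrightarrow> subspace B \<and> (\<forall>x\<in>B. \<forall>y\<in>B. x * y \<in> B)"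

text \<open>\<open>B \<cong> M\<^sub>n(\<F>)\<close> as \<open>\<F>\<close>-algebras.\<close>

definition iso_matrix_algebra :: "'a set \<Rightarrow> nat \<Rightarrow> bool" where
  "iso_matrix_algebra B n \<longleftrightarrow>
     (\<exists>\<phi> :: 'a \<Rightarrow> 'f mat. bij_betw \<phi> B (carrier_mat n n) \<and>
        (\<forall>x\<in>B. \<forall>y\<in>B. \<phi> (x + y) = \<phi> x + \<phi> y) \<and>
        (\<forall>c. \<forall>x\<in>B. \<phi> (c *s x) = c \<cdot>\<^sub>m \<phi> x) \<and>
        (\<forall>x\<in>B. \<forall>y\<in>B. \<phi> (x * y) = \<phi> x * \<phi> y))"

definition countable_dimensional :: bool where
  "countable_dimensional \<longleftrightarrow> (\<exists>B. independent B \<and> span B = UNIV \<and> |B| =o natLeq)"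

definition Aut :: "('a \<Rightarrow> 'a) monoid" where
  "Aut = \<lparr>carrier = {f. bij f \<and> Vector_Spaces.linear scale scale f \<and> (\<forall>x y. f (x * y) = f x * f y)},
          monoid.mult = (\<circ>), one = id\<rparr>"

definition is_identity :: "'a \<Rightarrow> bool" where
  "is_identity e \<longleftrightarrow> (\<forall>x. e * x = x \<and> x * e = x)"

definition unital :: bool where
  "unital \<longleftrightarrow> (\<exists>e. is_identity e)"

text \<open>
  The algebra \<open>A + \<F>\<cdot>1\<close> obtained by adjoining a unit: the pair \<open>(x, c)\<close> stands for \<open>x + c\<cdot>1\<close>,
  and \<open>x \<in> A\<close> is identified with \<open>(x, 0)\<close>.
\<close>

definition adj_mult :: "'a \<times> 'f \<Rightarrow> 'a \<times> 'f \<Rightarrow> 'a \<times> 'f" (infixl \<open>\<star>\<close> 70) where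
  "u \<star> v = (fst u * fst v + snd u *s fst v + snd v *s fst u, snd u * snd v)"

definition adj_one :: "'a \<times> 'f" where
  "adj_one = (0, 1)"

definition Inn :: "('a \<Rightarrow> 'a) set" where
  "Inn = {f.
     if unital
     then \<exists>e a b. is_identity e \<and> a * b = e \<and> b * a = e \<and> (\<forall>x. f x = b * x * a)
     else \<exists>u v. u \<star> v = adj_one \<and> v \<star> u = adj_one \<and> (\<forall>x. (f x, 0) = v \<star> (x, 0) \<star> u)}"

definition Out :: "('a \<Rightarrow> 'a) set monoid" where
  "Out = Aut Mod Inn"

lemma Aut_mem:
  "f \<in> carrier Aut \<longleftrightarrow> bij f \<and> (\<forall>x y. f (x + y) = f x + f y) \<and>
     (\<forall>c x. f (c *s x) = c *s f x) \<and> (\<forall>x y. f (x * y) = f x * f y)"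
  by (auto simp: Aut_def Vector_Spaces.linear_iff vector_space_axioms)

lemma Aut_simps [simp]: "f \<otimes>\<^bsub>Aut\<^esub> g = f \<circ> g" "\<one>\<^bsub>Aut\<^esub> = id"
  by (simp_all add: Aut_def)

lemma inv_mem_Aut:
  assumes "f \<in> carrier Aut"
  shows "Hilbert_Choice.inv f \<in> carrier Aut"
proof -
  let ?g = "Hilbert_Choice.inv f"
  have b: "bij f" and h: "\<And>x y. f (x + y) = f x + f y" "\<And>c x. f (c *s x) = c *s f x"
      "\<And>x y. f (x * y) = f x * f y"
    using assms by (auto simp: Aut_mem)
  have fg: "f (?g x) = x" and gf: "?g (f x) = x" for x
    using b by (simp_all add: bij_is_surj surj_f_inv_f bij_is_inj)
  have "?g (x + y) = ?g x + ?g y" "?g (x * y) = ?g x * ?g y" "?g (c *s x) = c *s ?g x" for x y c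
    by (metis fg gf h)+
  then show ?thesis using b by (auto simp: Aut_mem bij_imp_bij_inv)
qed

lemma group_Aut: "group Aut"
proof (rule groupI)
  fix f assume "f \<in> carrier Aut"
  then show "\<exists>g\<in>carrier Aut. g \<otimes>\<^bsub>Aut\<^esub> f = \<one>\<^bsub>Aut\<^esub>"
    by (intro bexI[of _ "Hilbert_Choice.inv f"] inv_mem_Aut) (auto simp: Aut_mem bij_is_inj)
qed (auto simp: Aut_mem bij_comp comp_assoc)

lemma inv_Aut: "f \<in> carrier Aut \<Longrightarrow> inv\<^bsub>Aut\<^esub> f = Hilbert_Choice.inv f"
  by (rule group.inv_equality[OF group_Aut]) (simp_all add: inv_mem_Aut, simp add: Aut_mem bij_is_inj)

lemma adj_assoc: "u \<star> v \<star> w = u \<star> (v \<star> w)"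
  by (simp add: adj_mult_def algebra_simps scale_mult_left scale_mult_right scale_right_distrib)

lemma adj_one_mult [simp]: "adj_one \<star> u = u" "u \<star> adj_one = u"
  by (simp_all add: adj_mult_def adj_one_def)

lemma adj_cancel: "u \<star> v = adj_one \<Longrightarrow> u \<star> (v \<star> w) = w"
  by (simp flip: adj_assoc)

text \<open>
  In the unital case the inner automorphisms are conjugations by invertible elements of
  \<open>A + \<F>\<cdot>1\<close> as well: \<open>a\<close> is replaced by \<open>a - e + 1\<close>.
\<close>

lemma Inn_adj:
  "f \<in> Inn \<longleftrightarrow>
     (\<exists>u v. u \<star> v = adj_one \<and> v \<star> u = adj_one \<and> (\<forall>x. (f x, 0) = v \<star> (x, 0) \<star> u))"
  (is "_ \<longleftrightarrow> ?R")
proof (cases unital)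
  case True
  then obtain e where e: "is_identity e" by (auto simp: unital_def)
  have e1: "e * x = x" "x * e = x" for x using e by (auto simp: is_identity_def)
  have eu: "e' = e" if "is_identity e'" for e'
    using that e by (metis is_identity_def)
  show ?thesis
  proof
    assume "f \<in> Inn"
    then obtain a b where ab: "a * b = e" "b * a = e" "\<And>x. f x = b * x * a"
      using True eu by (auto simp: Inn_def)
    have "(a - e, 1) \<star> (b - e, 1) = adj_one" "(b - e, 1) \<star> (a - e, 1) = adj_one"
      using ab by (simp_all add: adj_mult_def adj_one_def algebra_simps e1)
    moreover have "\<forall>x. (f x, 0) = (b - e, 1) \<star> (x, 0) \<star> (a - e, 1)"
      by (simp add: adj_mult_def algebra_simps e1 ab)
    ultimately show ?R by blast
  next
    assume ?R
    then obtain a c b d where uv: "(a, c) \<star> (b, d) = adj_one" "(b, d) \<star> (a, c) = adj_one"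
        "\<And>x. (f x, 0) = (b, d) \<star> (x, 0) \<star> (a, c)"
      by (metis surj_pair)
    define a' b' where "a' = a + c *s e" and "b' = b + d *s e"
    have "a' * b' = e" "b' * a' = e"
      using uv(1,2) by (simp_all add: adj_mult_def adj_one_def a'_def b'_def algebra_simps
          scale_mult_left scale_mult_right e1)
    moreover have "f x = b' * x * a'" for x
      using uv(3)[of x]
      by (simp add: adj_mult_def a'_def b'_def algebra_simps scale_right_distrib
          scale_mult_left scale_mult_right e1)
    ultimately show "f \<in> Inn" using True e by (auto simp: Inn_def)
  qed
qed (simp add: Inn_def)

lemma Inn_normal: "Inn \<lhd> Aut"
proof -
  interpret G: group Aut by (rule group_Aut)
  have adj_add: "v \<star> (x + y, 0) \<star> u = (fst (v \<star> (x, 0) \<star> u) + fst (v \<star> (y, 0) \<star> u), 0)" for u v x y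
    by (simp add: adj_mult_def algebra_simps scale_right_distrib)
  have adj_scale: "v \<star> (c *s x, 0) \<star> u = (c *s fst (v \<star> (x, 0) \<star> u), 0)" for u v x c
    by (simp add: adj_mult_def algebra_simps scale_mult_left scale_mult_right
        scale_right_distrib mult.commute)
  have adj_prod: "(x, 0) \<star> (y, 0) = (x * y, 0)" for x y
    by (simp add: adj_mult_def)
  have sub: "f \<in> carrier Aut \<and> Hilbert_Choice.inv f \<in> Inn" if f: "f \<in> Inn" for f
  proof -
    obtain u v where uv: "u \<star> v = adj_one" "v \<star> u = adj_one" "\<And>x. (f x, 0) = v \<star> (x, 0) \<star> u"
      using f by (auto simp: Inn_adj)
    define g where "g x = fst (u \<star> (x, 0) \<star> v)" for x
    have g: "(g x, 0) = u \<star> (x, 0) \<star> v" for x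
      by (simp add: g_def adj_mult_def)
    have "(f (g x), 0::'f) = (x, 0)" "(g (f x), 0::'f) = (x, 0)" for x
      by (simp_all add: uv g adj_assoc adj_cancel)
    then have fg: "f (g x) = x" "g (f x) = x" for x by auto
    then have "bij f" by (metis bijI')
    moreover have "f (x + y) = f x + f y" "f (c *s x) = c *s f x" for x y c
      using uv(3) adj_add adj_scale by (metis fst_conv)+
    moreover have "(f (x * y), 0::'f) = (f x * f y, 0)" for x y
      by (simp add: uv(3) flip: adj_prod) (simp add: uv adj_assoc adj_cancel)
    ultimately have "f \<in> carrier Aut" by (auto simp: Aut_mem)
    moreover have "Hilbert_Choice.inv f = g" using fg by (intro inv_equality)
    moreover have "g \<in> Inn" unfolding Inn_adj using uv(1,2) g by blast
    ultimately show ?thesis by simp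
  qed
  have "subgroup Inn Aut"
  proof (rule G.subgroupI)
    have "id \<in> Inn" unfolding Inn_adj by (intro exI[of _ adj_one]) simp
    then show "Inn \<noteq> {}" by blast
  next
    fix f g assume "f \<in> Inn" "g \<in> Inn"
    then obtain u v u' v' where *: "u \<star> v = adj_one" "v \<star> u = adj_one"
        "\<And>x. (f x, 0) = v \<star> (x, 0) \<star> u" "u' \<star> v' = adj_one" "v' \<star> u' = adj_one"
        "\<And>x. (g x, 0) = v' \<star> (x, 0) \<star> u'"
      by (auto simp: Inn_adj)
    show "f \<otimes>\<^bsub>Aut\<^esub> g \<in> Inn"
      unfolding Inn_adj by (intro exI[of _ "u' \<star> u"] exI[of _ "v \<star> v'"])
        (simp add: * adj_assoc adj_cancel)
  qed (use sub in \<open>auto simp: inv_Aut\<close>)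
  moreover have "h \<otimes>\<^bsub>Aut\<^esub> f \<otimes>\<^bsub>Aut\<^esub> inv\<^bsub>Aut\<^esub> h \<in> Inn" if h: "h \<in> carrier Aut" and f: "f \<in> Inn" for h f
  proof -
    obtain u v where uv: "u \<star> v = adj_one" "v \<star> u = adj_one" "\<And>x. (f x, 0) = v \<star> (x, 0) \<star> u"
      using f by (auto simp: Inn_adj)
    define H where "H = (\<lambda>w::'a \<times> 'f. (h (fst w), snd w))"
    have hh: "bij h" "\<And>x y. h (x + y) = h x + h y" "\<And>c x. h (c *s x) = c *s h x"
        "\<And>x y. h (x * y) = h x * h y"
      using h by (auto simp: Aut_mem)
    have H: "H (w \<star> z) = H w \<star> H z" for w z by (simp add: H_def adj_mult_def hh)
    have "h 0 = 0" using hh(2)[of 0 0] by simp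
    then have H1: "H adj_one = adj_one" by (simp add: H_def adj_one_def)
    have "(h (f (Hilbert_Choice.inv h x)), 0) = H v \<star> (x, 0) \<star> H u" for x
    proof -
      have "(h (f (Hilbert_Choice.inv h x)), 0) = H (f (Hilbert_Choice.inv h x), 0)"
        by (simp add: H_def)
      also have "\<dots> = H v \<star> H (Hilbert_Choice.inv h x, 0) \<star> H u" by (simp only: uv H)
      also have "H (Hilbert_Choice.inv h x, 0) = (x, 0)"
        using hh(1) by (simp add: H_def bij_is_surj surj_f_inv_f)
      finally show ?thesis .
    qed
    moreover have "H u \<star> H v = adj_one" "H v \<star> H u = adj_one"
      by (metis H H1 uv(1,2))+
    ultimately show ?thesis
      unfolding Inn_adj using h by (intro exI[of _ "H u"] exI[of _ "H v"]) (simp add: inv_Aut)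
  qed
  ultimately show ?thesis by (auto simp: G.normal_inv_iff)
qed

end

locale locally_matrix_algebra = nonunital_algebra scale
  for scale :: "'f::field \<Rightarrow> 'a::ring \<Rightarrow> 'a" (infixr \<open>*s\<close> 75) +
  assumes locally_matrix:
    "finite S \<Longrightarrow> \<exists>B n. S \<subseteq> B \<and> is_subalgebra B \<and> n > 0 \<and> iso_matrix_algebra B n"

end

theory Submission
  imports Defs "HOL-Library.Nat_Bijection"
begin

text \<open>
  The upper bound is linear algebra: an automorphism is determined by its matrix in a countable
  basis, that is, by a sequence of scalars, and \<open>Out\<close> is a quotient of \<open>Aut\<close>. The content is an
  injection of the sequences of scalars into \<open>Out\<close>. It has to be explicit, because comparing the
  sizes of \<open>Aut\<close> and \<open>Inn\<close> says nothing over a field with as many elements as sequences of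
  elements, such as the reals.

  Suppose that \<open>A\<close> is the union of a chain of subalgebras \<open>S\<^sub>0 \<subseteq> S\<^sub>1 \<subseteq> \<dots>\<close> and that, for every \<open>n\<close>,
  there are \<open>z\<^sub>n\<close> and \<open>y\<^sub>n\<close> in \<open>S\<^sub>n\<^sub>+\<^sub>1\<close> that centralize \<open>S\<^sub>n\<close> and satisfy \<open>z\<^sub>n\<^sup>2 = 0\<close> and
  \<open>z\<^sub>n y\<^sub>n \<noteq> y\<^sub>n z\<^sub>n\<close>. For every sequence \<open>t\<close> of scalars the infinite product of the conjugations by
  the invertible elements \<open>1 + t\<^sub>n z\<^sub>n\<close> makes sense, because on a given element all but finitely many
  factors act trivially. The elements \<open>z\<^sub>n\<close> commute and have square zero, so this defines a
  homomorphism from the additive group of sequences into \<open>Aut\<close>. An element \<open>a\<close> of the algebra lies in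
  some \<open>S\<^sub>m\<close>, so conjugation by \<open>a + c\<cdot>1\<close> fixes \<open>y\<^sub>n\<close> for all \<open>n \<ge> m\<close>, whereas the product moves
  \<open>y\<^sub>n\<close> unless \<open>t\<^sub>n = 0\<close>. Hence only sequences that are eventually zero give inner automorphisms, and
  sequences that differ infinitely often have different classes in \<open>Out\<close>
  (\<open>limit_conj_same_coset\<close>). Repeating every entry of a sequence infinitely often makes different
  sequences differ infinitely often. Working with nilpotent elements makes the argument uniform in
  the field: \<open>1 + t z\<close> is invertible for every scalar \<open>t\<close>, whereas conjugations by diagonal elements
  would be trivial over the field with two elements.

  It remains to find \<open>z\<close> and \<open>y\<close> that centralize a given subalgebra \<open>B \<cong> M\<^sub>d(\<F>)\<close> with matrix units
  \<open>e\<^sub>i\<^sub>j\<close> and unity \<open>e\<close> (\<open>centralizing_nilpotent\<close>). Take a much larger matrix subalgebra \<open>M\<close> with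
  unity \<open>u\<close>. Elements of the corner \<open>(u - e) M (u - e)\<close> annihilate \<open>B\<close>, and elements of the corner
  \<open>e\<^sub>0\<^sub>0 M e\<^sub>0\<^sub>0\<close> become elements of the centralizer when they are repeated along the diagonal. A corner
  of a matrix algebra either contains a suitable pair or consists of the scalar multiples of its
  idempotent (\<open>corner_dichotomy\<close>). If both corners consisted of scalars, then the Peirce
  decomposition of \<open>M\<close> would have at most \<open>(d + 1)\<^sup>2\<close> one-dimensional pieces, and \<open>M\<close> would not be
  large.
\<close>

section \<open>Matrix units and corners of matrix algebras\<close>

locale matrix_units = nonunital_algebra scale
  for scale :: "'f::field \<Rightarrow> 'a::ring \<Rightarrow> 'a" (infixr \<open>*s\<close> 75) +
  fixes d :: nat and E :: "nat \<Rightarrow> nat \<Rightarrow> 'a"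
  assumes dim_pos: "0 < d"
    and unit_mult: "\<lbrakk>i < d; j < d; k < d; l < d\<rbrakk> \<Longrightarrow> E i j * E k l = (if j = k then E i l else 0)"
    and unit_nonzero: "\<lbrakk>i < d; j < d\<rbrakk> \<Longrightarrow> E i j \<noteq> 0"
begin

definition alg :: "'a set" where
  "alg = span (case_prod E ` ({..<d} \<times> {..<d}))"

definition unity :: 'a where
  "unity = (\<Sum>i<d. E i i)"

lemma subspace_alg: "subspace alg"
  by (simp add: alg_def)

lemma unit_in_alg [simp]: "i < d \<Longrightarrow> j < d \<Longrightarrow> E i j \<in> alg"
  unfolding alg_def by (rule span_base) auto

lemma alg_induct [consumes 1, case_names subspace unit]:
  assumes "x \<in> alg" "subspace {x. P x}" "\<And>i j. i < d \<Longrightarrow> j < d \<Longrightarrow> P (E i j)"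
  shows "P x"
  using assms(1) unfolding alg_def
  by (rule span_induct[of _ _ P]) (use assms(2,3) in auto)

lemma unity_in_alg [simp]: "unity \<in> alg"
  unfolding unity_def by (rule subspace_sum[OF subspace_alg]) auto

lemma alg_mult [simp]: "x \<in> alg \<Longrightarrow> y \<in> alg \<Longrightarrow> x * y \<in> alg"
proof (induction x rule: alg_induct)
  case subspace
  show ?case
    using subspace_0[OF subspace_alg] subspace_add[OF subspace_alg] subspace_scale[OF subspace_alg]
    by (auto intro!: subspaceI simp: distrib_right scale_mult_left)
next
  case (unit i j)
  from unit(3) show ?case
  proof (induction y rule: alg_induct)
    case subspace
    show ?case
      using subspace_0[OF subspace_alg] subspace_add[OF subspace_alg] subspace_scale[OF subspace_alg]
      by (auto intro!: subspaceI simp: distrib_left scale_mult_right)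
  next
    case (unit k l)
    then show ?case
      using \<open>i < d\<close> \<open>j < d\<close> subspace_0[OF subspace_alg] by (auto simp: unit_mult)
  qed
qed

lemma unity_mult [simp]: "x \<in> alg \<Longrightarrow> unity * x = x"
proof (induction x rule: alg_induct)
  case subspace
  show ?case by (auto intro!: subspaceI simp: distrib_left scale_mult_right)
next
  case (unit i j)
  have "unity * E i j = (\<Sum>k<d. if k = i then E i j else 0)"
    unfolding unity_def sum_distrib_right using unit by (intro sum.cong) (auto simp: unit_mult)
  then show ?case using unit by simp
qed

lemma mult_unity [simp]: "x \<in> alg \<Longrightarrow> x * unity = x"
proof (induction x rule: alg_induct)
  case subspace
  show ?case by (auto intro!: subspaceI simp: distrib_right scale_mult_left)
next
  case (unit i j)
  have "E i j * unity = (\<Sum>k<d. if k = j then E i j else 0)"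
    unfolding unity_def sum_distrib_left using unit by (intro sum.cong) (auto simp: unit_mult)
  then show ?case using unit by simp
qed

lemma unit_sandwich:
  assumes "x \<in> alg" "i < d" "j < d" "k < d" "l < d"
  shows "\<exists>c. E i j * x * E k l = c *s E i l"
  using assms(1)
proof (induction x rule: alg_induct)
  case subspace
  have "\<exists>c. E i j * 0 * E k l = c *s E i l" by (auto intro: exI[of _ 0])
  moreover have "\<exists>c. E i j * (x + y) * E k l = c *s E i l"
    if "E i j * x * E k l = a *s E i l" "E i j * y * E k l = b *s E i l" for x y a b
    using that by (auto intro!: exI[of _ "a + b"] simp: distrib_left distrib_right scale_left_distrib)
  moreover have "\<exists>c. E i j * (r *s x) * E k l = c *s E i l"
    if "E i j * x * E k l = a *s E i l" for x a r
    using that by (auto intro!: exI[of _ "r * a"] simp: scale_mult_left scale_mult_right)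
  ultimately show ?case by (auto intro!: subspaceI)
next
  case (unit p q)
  have "E i j * E p q * E k l = (if j = p \<and> q = k then 1 else 0) *s E i l"
    using assms unit by (auto simp: unit_mult)
  then show ?case by blast
qed

lemma nonzero_entry:
  assumes "x \<in> alg" "x \<noteq> 0"
  obtains i j c where "i < d" "j < d" "c \<noteq> 0" "E i i * x * E j j = c *s E i j"
proof -
  have "x = unity * x * unity" using assms by simp
  also have "\<dots> = (\<Sum>i<d. \<Sum>j<d. E i i * x * E j j)"
    unfolding unity_def sum_distrib_left sum_distrib_right by (rule sum.swap)
  finally obtain i j where ij: "i < d" "j < d" "E i i * x * E j j \<noteq> 0"
    using assms(2) by (metis (no_types, lifting) lessThan_iff sum.neutral)
  obtain c where "E i i * x * E j j = c *s E i j"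
    using unit_sandwich assms(1) ij by blast
  with ij that show ?thesis by (metis scale_zero_left)
qed

text \<open>
  Matrix algebras are prime. The corner lemmas below rest on this and on the fact that \<open>E 0 0\<close>
  has rank one (\<open>unit_sandwich\<close>).
\<close>

lemma alg_prime:
  assumes "x \<in> alg" "x \<noteq> 0" "y \<in> alg" "y \<noteq> 0"
  obtains a where "a \<in> alg" "x * a * y \<noteq> 0"
proof -
  obtain i j c where x: "i < d" "j < d" "c \<noteq> 0" "E i i * x * E j j = c *s E i j"
    using nonzero_entry assms by metis
  obtain k l c' where y: "k < d" "l < d" "c' \<noteq> 0" "E k k * y * E l l = c' *s E k l"
    using nonzero_entry assms by metis
  have "E i i * (x * E j k * y) * E l l = (E i i * x * E j j) * E j k * (E k k * y * E l l)"
  proof -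
    have "E j k = E j j * E j k * E k k" using x y by (simp add: unit_mult)
    then show ?thesis by (metis mult.assoc)
  qed
  also have "\<dots> = (c * c') *s E i l"
    unfolding x(4) y(4) using x y by (simp add: scale_mult_left scale_mult_right unit_mult mult.commute)
  also have "\<dots> \<noteq> 0" using x y unit_nonzero by simp
  finally have "x * E j k * y \<noteq> 0" by auto
  then show ?thesis by (rule that[OF unit_in_alg[OF x(2) y(1)]])
qed

text \<open>
  A nonzero element \<open>z\<close> of square zero in the corner of \<open>g\<close> is noncentral there, since
  primeness gives \<open>z y z \<noteq> 0\<close> for some \<open>y\<close>. If there is no such \<open>z\<close>, then an element of rank one in
  the corner is, up to a scalar, an idempotent \<open>s\<close>. The elements \<open>(g - s) x s\<close> have square zero, so
  they vanish, and primeness yields \<open>s = g\<close>: the corner has rank one.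
\<close>

lemma corner_dichotomy:
  assumes g: "g \<in> alg" "g * g = g"
  obtains (scalar) "\<And>x. x \<in> alg \<Longrightarrow> \<exists>c. g * x * g = c *s g"
  | (nilpotent) z y where "z \<in> alg" "y \<in> alg" "g * z * g = z" "g * y * g = y" "z * z = 0" "z * y \<noteq> y * z"
proof (cases "\<exists>z\<in>alg. g * z * g = z \<and> z * z = 0 \<and> z \<noteq> 0")
  case True
  then obtain z where z: "z \<in> alg" "g * z * g = z" "z * z = 0" "z \<noteq> 0" by blast
  obtain a where a: "a \<in> alg" "z * a * z \<noteq> 0" using alg_prime z by metis
  define y where "y = g * a * g"
  have zg: "z * g = z" "g * z = z" using z(2) g(2) by (metis mult.assoc)+
  have "z * y * z = z * a * z" using zg by (simp add: y_def mult.assoc) (metis mult.assoc zg)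
  then have "z * y \<noteq> y * z" using a z(3) by (metis mult.assoc mult_zero_right)
  moreover have "g * y * g = y" "y \<in> alg" using g a by (simp_all add: y_def mult.assoc) (metis mult.assoc g(2))
  ultimately show ?thesis using nilpotent z by blast
next
  case False
  then have reduced: "z = 0" if "z \<in> alg" "g * z * g = z" "z * z = 0" for z using that by blast
  have gg: "g * (g * x) = g * x" for x using g(2) by (metis mult.assoc)
  show ?thesis
  proof (cases "g = 0")
    case True then show ?thesis using scalar by (auto intro: exI[of _ 0])
  next
    case g0: False
    have e: "E 0 0 \<in> alg" "E 0 0 \<noteq> 0" using dim_pos unit_nonzero by auto
    obtain a where a: "a \<in> alg" "g * a * E 0 0 \<noteq> 0" using alg_prime[OF g(1) g0 e] by metis
    obtain b where b: "b \<in> alg" "g * a * E 0 0 * b * g \<noteq> 0"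
      using alg_prime[OF _ a(2) g(1) g0] a g e by (metis alg_mult)
    define r where "r = g * a * E 0 0 * b * g"
    have r: "r \<in> alg" "g * r = r" "r * g = r" "r \<noteq> 0"
      using a b g e by (simp_all add: r_def mult.assoc gg)
    \<comment> \<open>\<open>r\<close> inherits rank one from \<open>E 0 0\<close>.\<close>
    have rr: "\<exists>c. r * x * r = c *s r" if "x \<in> alg" for x
    proof -
      have "r * x * r = g * a * (E 0 0 * (b * g * x * g * a) * E 0 0) * b * g"
        by (simp add: r_def mult.assoc)
      moreover have "b * g * x * g * a \<in> alg" using a b g that by simp
      then obtain c where "E 0 0 * (b * g * x * g * a) * E 0 0 = c *s E 0 0"
        using unit_sandwich dim_pos by blast
      ultimately have "r * x * r = c *s r"
        by (simp add: r_def scale_mult_left scale_mult_right)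
      then show ?thesis by blast
    qed
    obtain l where l: "r * r = l *s r" using rr[OF g(1)] r by auto
    have "l \<noteq> 0" using reduced[of r] r l by auto
    define s where "s = inverse l *s r"
    have s: "s \<in> alg" "g * s = s" "s * g = s" "s \<noteq> 0" "s * s = s"
      using r \<open>l \<noteq> 0\<close> l subspace_scale[OF subspace_alg]
      by (simp_all add: s_def scale_mult_left scale_mult_right)
    have gs: "g - s \<in> alg" using g s subspace_diff[OF subspace_alg] by blast
    have "(g - s) * x * s = 0" if "x \<in> alg" for x
    proof (rule reduced)
      show "g * ((g - s) * x * s) * g = (g - s) * x * s"
        by (simp add: algebra_simps s gg) (metis s(2) mult.assoc)
      have "s * (g - s) = 0" by (simp add: s algebra_simps)
      then show "(g - s) * x * s * ((g - s) * x * s) = 0" by (metis mult.assoc mult_zero_left mult_zero_right)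
    qed (use gs s that in simp)
    then have "g = s" using alg_prime[OF gs _ s(1,4)] by (metis eq_iff_diff_eq_0)
    have "\<exists>c. g * x * g = c *s g" if x: "x \<in> alg" for x
    proof -
      obtain c where "r * x * r = c *s r" using rr x by blast
      then have "s * x * s = (inverse l * c) *s s"
        by (simp add: s_def scale_mult_left scale_mult_right)
      then show ?thesis using \<open>g = s\<close> by blast
    qed
    then show ?thesis using scalar by blast
  qed
qed

text \<open>
  If some \<open>v = p x\<^sub>0 q\<close> is nonzero, primeness provides \<open>y\<close> with \<open>q y v = c q\<close> and \<open>c \<noteq> 0\<close>. Every
  \<open>p x q\<close> is then a multiple of \<open>p x q y v\<close>, which lies in \<open>(p M p) v\<close> and so is a multiple of \<open>v\<close>.
\<close>

lemma off_diagonal_corner: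
  assumes p: "p \<in> alg" "p * p = p" "\<And>x. x \<in> alg \<Longrightarrow> \<exists>c. p * x * p = c *s p"
    and q: "q \<in> alg" "q * q = q" "\<And>x. x \<in> alg \<Longrightarrow> \<exists>c. q * x * q = c *s q"
  obtains v where "\<And>x. x \<in> alg \<Longrightarrow> \<exists>c. p * x * q = c *s v"
proof (cases "\<exists>x\<in>alg. p * x * q \<noteq> 0")
  case False
  then show ?thesis using that[of 0] by auto
next
  case True
  then obtain x0 where x0: "x0 \<in> alg" "p * x0 * q \<noteq> 0" by blast
  define v where "v = p * x0 * q"
  have pp: "p * (p * x) = p * x" and qq: "q * (q * x) = q * x" for x using p(2) q(2) by (metis mult.assoc)+
  have v: "v \<in> alg" "p * v = v" "v * q = v" "v \<noteq> 0" using p q x0 by (simp_all add: v_def mult.assoc pp)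
  obtain y where y: "y \<in> alg" "v * y * v \<noteq> 0" using alg_prime v by metis
  obtain c where c: "q * (y * v) * q = c *s q" using q(3) y v by (meson alg_mult)
  have qyv: "q * (y * v) = c *s q" using c v(3) by (simp add: mult.assoc)
  have "v * y * v = c *s v" using qyv v(3) by (metis mult.assoc scale_mult_right)
  then have "c \<noteq> 0" using y by auto
  have "\<exists>c. p * x * q = c *s v" if x: "x \<in> alg" for x
  proof -
    have "p * x * q * y \<in> alg" using x y p q by simp
    then obtain c' where c': "p * (p * x * q * y) * p = c' *s p" using p(3) by blast
    have "c *s (p * x * q) = p * x * (q * (y * v))"
      unfolding qyv by (simp add: scale_mult_right)
    also have "\<dots> = p * (p * x * q * y) * p * v" using v(2) by (simp add: mult.assoc pp)
    also have "\<dots> = c' *s v" unfolding c' using v(2) by (simp add: scale_mult_left)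
    finally have "p * x * q = (inverse c * c') *s v"
      using \<open>c \<noteq> 0\<close> by (metis scale_scale left_inverse scale_one)
    then show ?thesis by blast
  qed
  then show ?thesis using that by blast
qed

text \<open>
  In block form this is the matrix with \<open>a\<close> in every diagonal block. Here \<open>a\<close> ranges over the
  corner of \<open>E 0 0\<close> in an algebra that may be larger than \<open>alg\<close>, and \<open>diag a\<close> centralizes \<open>alg\<close>.
\<close>

definition diag :: "'a \<Rightarrow> 'a" where
  "diag a = (\<Sum>i<d. E i 0 * a * E 0 i)"

lemma unit_diag: "k < d \<Longrightarrow> l < d \<Longrightarrow> E k l * diag a = E k 0 * a * E 0 l"
proof -
  assume kl: "k < d" "l < d"
  have "E k l * diag a = (\<Sum>i<d. if i = l then E k 0 * a * E 0 l else 0)"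
    unfolding diag_def sum_distrib_left
    using kl dim_pos by (intro sum.cong) (auto simp: unit_mult simp flip: mult.assoc)
  then show ?thesis using kl by simp
qed

lemma diag_unit: "k < d \<Longrightarrow> l < d \<Longrightarrow> diag a * E k l = E k 0 * a * E 0 l"
proof -
  assume kl: "k < d" "l < d"
  have "diag a * E k l = (\<Sum>i<d. if i = k then E k 0 * a * E 0 l else 0)"
    unfolding diag_def sum_distrib_right
    using kl dim_pos by (intro sum.cong) (auto simp: unit_mult mult.assoc)
  then show ?thesis using kl by simp
qed

lemma diag_commutes: "x \<in> alg \<Longrightarrow> diag a * x = x * diag a"
proof (induction x rule: alg_induct)
  case subspace
  show ?case by (auto intro!: subspaceI simp: algebra_simps scale_mult_left scale_mult_right)
next
  case (unit i j)
  then show ?case by (simp add: unit_diag diag_unit)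
qed

lemma diag_corner:
  assumes "E 0 0 * a * E 0 0 = a"
  shows "E 0 0 * diag a = a"
  using unit_diag[of 0 0 a] dim_pos assms by simp

lemma diag_mult:
  assumes a: "E 0 0 * a * E 0 0 = a"
  shows "diag a * diag b = diag (a * b)"
proof -
  have "a * E 0 0 = a" using dim_pos by (metis a mult.assoc unit_mult)
  then have "E i 0 * a * E 0 i * diag b = E i 0 * (a * b) * E 0 i" if "i < d" for i
    using that dim_pos by (simp add: mult.assoc unit_diag) (simp flip: mult.assoc add: a)
  then show ?thesis by (simp add: diag_def[of a] diag_def[of "a * b"] sum_distrib_right)
qed

end

context nonunital_algebra
begin

lemma matrix_units_of_iso:
  assumes sub: "is_subalgebra B" and n: "0 < n" and iso: "iso_matrix_algebra B n"
  obtains E where "matrix_units scale n E" "matrix_units.alg scale n E = B"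
proof -
  obtain \<phi> :: "'a \<Rightarrow> 'f mat" where \<phi>: "bij_betw \<phi> B (carrier_mat n n)"
      "\<And>x y. x \<in> B \<Longrightarrow> y \<in> B \<Longrightarrow> \<phi> (x + y) = \<phi> x + \<phi> y"
      "\<And>c x. x \<in> B \<Longrightarrow> \<phi> (c *s x) = c \<cdot>\<^sub>m \<phi> x"
      "\<And>x y. x \<in> B \<Longrightarrow> y \<in> B \<Longrightarrow> \<phi> (x * y) = \<phi> x * \<phi> y"
    using iso unfolding iso_matrix_algebra_def by blast
  have B: "subspace B" "\<And>x y. x \<in> B \<Longrightarrow> y \<in> B \<Longrightarrow> x * y \<in> B"
    using sub by (auto simp: is_subalgebra_def)
  note B0 = subspace_0[OF B(1)]
  have carr: "\<phi> x \<in> carrier_mat n n" if "x \<in> B" for x using \<phi>(1) that by (auto simp: bij_betw_def)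
  have inj: "x = y" if "\<phi> x = \<phi> y" "x \<in> B" "y \<in> B" for x y
    using \<phi>(1) that by (auto simp: bij_betw_def inj_on_def)
  have "\<phi> (0 *s 0) = 0 \<cdot>\<^sub>m \<phi> 0" using \<phi>(3) B0 by blast
  also have "\<dots> = 0\<^sub>m n n" using carr[OF B0] by (intro eq_matI) auto
  finally have \<phi>0: "\<phi> 0 = 0\<^sub>m n n" by simp
  define u :: "nat \<Rightarrow> nat \<Rightarrow> 'f mat" where "u i j = mat n n (\<lambda>p. if p = (i, j) then 1 else 0)" for i j
  define E where "E i j = inv_into B \<phi> (u i j)" for i j
  have uc: "u i j \<in> \<phi> ` B" for i j using \<phi>(1) by (auto simp: bij_betw_def u_def)
  have E: "\<phi> (E i j) = u i j" "E i j \<in> B" for i j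
    using f_inv_into_f[OF uc] inv_into_into[OF uc] by (auto simp: E_def)
  have uu: "u i j * u k l = (if j = k then u i l else 0\<^sub>m n n)"
    if "i < n" "j < n" "k < n" "l < n" for i j k l
  proof (rule eq_matI, goal_cases)
    case (1 a b)
    then have ab: "a < n" "b < n" by (auto simp: u_def split: if_splits)
    have "(u i j * u k l) $$ (a, b) = (\<Sum>m<n. (if a = i \<and> m = j then 1 else 0) * (if m = k \<and> b = l then 1 else 0))"
      using ab by (auto simp: u_def scalar_prod_def atLeast0LessThan intro!: sum.cong)
    also have "\<dots> = (\<Sum>m<n. if m = j then (if a = i \<and> j = k \<and> b = l then 1 else 0) else 0)"
      by (intro sum.cong) auto
    finally show ?case using ab that by (auto simp: u_def)
  qed (auto simp: u_def)
  have mu: "matrix_units scale n E"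
  proof unfold_locales
    fix i j k l assume ijkl: "i < n" "j < n" "k < n" "l < n"
    show "E i j * E k l = (if j = k then E i l else 0)"
      using uu[OF ijkl] E B B0 by (intro inj) (auto simp: \<phi>(4) \<phi>0)
  next
    fix i j assume "i < n" "j < n"
    then have "u i j $$ (i, j) \<noteq> 0\<^sub>m n n $$ (i, j)" by (simp add: u_def)
    then show "E i j \<noteq> 0" using E(1) \<phi>0 by metis
  qed (use n in simp)
  interpret M: matrix_units scale n E by (rule mu)
  have sum: "sum f I \<in> B \<and> \<phi> (sum f I) = mat n n (\<lambda>p. \<Sum>i\<in>I. \<phi> (f i) $$ p)"
    if "finite I" "\<And>i. i \<in> I \<Longrightarrow> f i \<in> B" for I :: "(nat \<times> nat) set" and f
    using that
  proof (induction I)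
    case empty
    then show ?case using B0 \<phi>0 by auto
  next
    case (insert i I)
    then have "f i \<in> B" "sum f I \<in> B" "\<phi> (sum f I) = mat n n (\<lambda>p. \<Sum>i\<in>I. \<phi> (f i) $$ p)"
      by auto
    with insert(1,2) show ?case
      using \<phi>(2) subspace_add[OF B(1)] carr[of "f i"] by auto
  qed
  have "M.alg \<subseteq> B" unfolding M.alg_def using E B(1) by (intro span_minimal) auto
  moreover have "x \<in> M.alg" if x: "x \<in> B" for x
  proof -
    define f where "f p = (\<phi> x $$ p) *s case_prod E p" for p
    define y where "y = (\<Sum>p\<in>{..<n}\<times>{..<n}. f p)"
    have f: "f p \<in> B" for p using E subspace_scale[OF B(1)] by (auto simp: f_def split: prod.splits)
    have y: "y \<in> B" "\<phi> y = mat n n (\<lambda>p. \<Sum>q\<in>{..<n}\<times>{..<n}. \<phi> (f q) $$ p)"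
      using sum[of "{..<n}\<times>{..<n}" f] f by (auto simp: y_def)
    have "\<phi> y = \<phi> x"
    proof (rule eq_matI)
      fix a b assume "a < dim_row (\<phi> x)" "b < dim_col (\<phi> x)"
      then have ab: "a < n" "b < n" using carr[OF x] by auto
      have "\<phi> y $$ (a, b) = (\<Sum>q\<in>{..<n}\<times>{..<n}. \<phi> (f q) $$ (a, b))" using ab y by simp
      also have "\<dots> = (\<Sum>q\<in>{..<n}\<times>{..<n}. if q = (a, b) then \<phi> x $$ q else 0)"
      proof (intro sum.cong refl)
        fix q :: "nat \<times> nat"
        obtain i j where q: "q = (i, j)" by (cases q)
        have "\<phi> (f q) = (\<phi> x $$ q) \<cdot>\<^sub>m u i j" using E by (simp add: f_def q \<phi>(3))
        then show "\<phi> (f q) $$ (a, b) = (if q = (a, b) then \<phi> x $$ q else 0)"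
          using ab by (auto simp: u_def q)
      qed
      also have "\<dots> = \<phi> x $$ (a, b)" using ab by simp
      finally show "\<phi> y $$ (a, b) = \<phi> x $$ (a, b)" .
    qed (use carr x y in auto)
    then have "y = x" using inj x y by blast
    moreover have "y \<in> M.alg"
      unfolding y_def f_def
      by (rule subspace_sum[OF M.subspace_alg]) (auto intro!: subspace_scale[OF M.subspace_alg])
    ultimately show ?thesis by simp
  qed
  ultimately have "M.alg = B" by blast
  with mu that show ?thesis by blast
qed

end

section \<open>Nilpotent elements in centralizers of matrix subalgebras\<close>

context locally_matrix_algebra
begin

lemma matrix_subalgebra_containing:
  assumes "finite S"
  obtains n E where "matrix_units scale n E" "S \<subseteq> matrix_units.alg scale n E"
  using locally_matrix[OF assms] matrix_units_of_iso by metis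

text \<open>
  The larger matrix algebra is chosen to contain \<open>(d + 1)\<^sup>2 + 1\<close> independent elements, one more than
  its Peirce decomposition with respect to \<open>e 0 0, \<dots>, e (d - 1) (d - 1)\<close> and the complementary
  idempotent \<open>g\<close> would allow if the corners of \<open>e 0 0\<close> and \<open>g\<close> consisted of scalars.
\<close>

lemma centralizing_nilpotent:
  assumes mu: "matrix_units scale d e" and D: "independent D" "infinite D"
  obtains z y where "z * z = 0" "z * y \<noteq> y * z"
    "\<And>x. x \<in> matrix_units.alg scale d e \<Longrightarrow> z * x = x * z \<and> y * x = x * y"
proof -
  interpret B: matrix_units scale d e by (rule mu)
  obtain I where I: "I \<subseteq> D" "finite I" "card I = (d + 1) * (d + 1) + 1"
    using infinite_arbitrarily_large[OF D(2)] by metis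
  have "finite (I \<union> case_prod e ` ({..<d} \<times> {..<d}))" using I by simp
  then obtain n E where mu': "matrix_units scale n E"
      and IM: "I \<union> case_prod e ` ({..<d} \<times> {..<d}) \<subseteq> matrix_units.alg scale n E"
    using matrix_subalgebra_containing by metis
  interpret M: matrix_units scale n E by (rule mu')
  have e [simp]: "e i j \<in> M.alg" if "i < d" "j < d" for i j using IM that by auto
  have BM: "B.alg \<subseteq> M.alg"
    unfolding B.alg_def by (rule span_minimal) (use IM M.subspace_alg in auto)
  define f g where "f = e 0 0" and "g = M.unity - B.unity"
  have Bu: "B.unity \<in> M.alg" "B.unity * B.unity = B.unity" using BM by auto
  have g: "g \<in> M.alg" "g * g = g" using Bu subspace_diff[OF M.subspace_alg]
    by (auto simp: g_def algebra_simps)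
  have f: "f \<in> M.alg" "f * f = f" using B.dim_pos by (auto simp: f_def B.unit_mult)
  have gB: "g * x = 0" "x * g = 0" if "x \<in> B.alg" for x
    using that BM by (auto simp: g_def algebra_simps)
  show ?thesis
    using f
  proof (cases rule: M.corner_dichotomy)
    case (nilpotent z y)
    have c: "e 0 0 * z * e 0 0 = z" "e 0 0 * y * e 0 0 = y"
      using nilpotent by (auto simp: f_def)
    have "B.diag z * B.diag z = 0"
      using nilpotent c by (simp add: B.diag_mult) (simp add: B.diag_def)
    moreover have "B.diag z * B.diag y \<noteq> B.diag y * B.diag z"
    proof
      assume "B.diag z * B.diag y = B.diag y * B.diag z"
      then have "e 0 0 * B.diag (z * y) = e 0 0 * B.diag (y * z)" using c by (simp add: B.diag_mult)
      moreover have "e 0 0 * (z * y) * e 0 0 = z * y" "e 0 0 * (y * z) * e 0 0 = y * z"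
        using c f unfolding f_def by (metis mult.assoc)+
      ultimately have "z * y = y * z" by (simp add: B.diag_corner)
      with nilpotent show False by simp
    qed
    ultimately show ?thesis using that B.diag_commutes by blast
  next
    case fscalar: scalar
    show ?thesis
      using g
    proof (cases rule: M.corner_dichotomy)
      case (nilpotent z y)
      have "z * x = x * z \<and> y * x = x * y" if "x \<in> B.alg" for x
        using gB[OF that] nilpotent(3,4) by (metis mult.assoc mult_zero_left mult_zero_right)
      then show ?thesis using that nilpotent by blast
    next
      case gscalar: scalar
      obtain v where v: "\<And>x. x \<in> M.alg \<Longrightarrow> \<exists>c. f * x * g = c *s v"
        using M.off_diagonal_corner[OF f fscalar g gscalar] by blast
      obtain w where w: "\<And>x. x \<in> M.alg \<Longrightarrow> \<exists>c. g * x * f = c *s w"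
        using M.off_diagonal_corner[OF g gscalar f fscalar] by blast
      \<comment> \<open>One spanning vector for each piece of the Peirce decomposition.\<close>
      define T where "T = case_prod e ` ({..<d} \<times> {..<d}) \<union> (\<lambda>i. e i 0 * v) ` {..<d}
        \<union> (\<lambda>j. w * e 0 j) ` {..<d} \<union> {g}"
      have T: "finite T" by (simp add: T_def)
      have "card T \<le> d * d + d + d + 1"
        unfolding T_def
        by (intro order.trans[OF card_Un_le] add_mono order.trans[OF card_image_le]) auto
      then have cardT: "card T \<le> (d + 1) * (d + 1)" by simp
      have Ts: "t \<in> span T" if "t \<in> T" for t using that by (rule span_base)
      have "x \<in> span T" if x: "x \<in> M.alg" for x
      proof -
        have ii: "e i i = e i 0 * f * e 0 i" "e i 0 * f = e i 0" "f * e 0 i = e 0 i" if "i < d" for i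
          using that B.dim_pos by (simp_all add: f_def B.unit_mult)
        have u: "M.unity = B.unity + g" by (simp add: g_def)
        have "B.unity * x * B.unity = (\<Sum>j<d. \<Sum>i<d. e i i * x * e j j)"
          by (simp add: B.unity_def sum_distrib_left sum_distrib_right)
        also have "\<dots> \<in> span T"
        proof (intro span_sum)
          fix i j assume "j \<in> {..<d}" "i \<in> {..<d}"
          then have ij: "i < d" "j < d" by auto
          have "e 0 i * x * e j 0 \<in> M.alg" using ij x B.dim_pos by simp
          then obtain c where c: "f * (e 0 i * x * e j 0) * f = c *s f" using fscalar by blast
          have "e i i * x * e j j = e i 0 * (f * (e 0 i * x * e j 0) * f) * e 0 j"
            using ij ii by (metis mult.assoc)
          also have "\<dots> = c *s e i j"
            unfolding c using ij B.dim_pos by (simp add: scale_mult_left scale_mult_right f_def B.unit_mult)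
          moreover have "e i j \<in> T" using ij by (force simp: T_def)
          ultimately show "e i i * x * e j j \<in> span T" by (simp add: span_scale Ts)
        qed
        finally have 1: "B.unity * x * B.unity \<in> span T" .
        have "B.unity * x * g = (\<Sum>i<d. e i i * x * g)"
          by (simp add: B.unity_def sum_distrib_right)
        also have "\<dots> \<in> span T"
        proof (intro span_sum)
          fix i assume "i \<in> {..<d}"
          then have i: "i < d" by auto
          obtain c where c: "f * (e 0 i * x) * g = c *s v" using v[of "e 0 i * x"] i x B.dim_pos by auto
          have "e i i * x * g = e i 0 * (f * (e 0 i * x) * g)"
            using i ii by (metis mult.assoc)
          also have "\<dots> = c *s (e i 0 * v)" unfolding c by (simp add: scale_mult_right)
          moreover have "e i 0 * v \<in> T" using i by (auto simp: T_def)
          ultimately show "e i i * x * g \<in> span T" by (simp add: span_scale Ts)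
        qed
        finally have 2: "B.unity * x * g \<in> span T" .
        have "g * x * B.unity = (\<Sum>i<d. g * x * e i i)"
          by (simp add: B.unity_def sum_distrib_left)
        also have "\<dots> \<in> span T"
        proof (intro span_sum)
          fix i assume "i \<in> {..<d}"
          then have i: "i < d" by auto
          obtain c where c: "g * (x * e i 0) * f = c *s w" using w[of "x * e i 0"] i x B.dim_pos by auto
          have "g * x * e i i = (g * (x * e i 0) * f) * e 0 i"
            using i ii by (metis mult.assoc)
          also have "\<dots> = c *s (w * e 0 i)" unfolding c by (simp add: scale_mult_left)
          moreover have "w * e 0 i \<in> T" using i by (auto simp: T_def)
          ultimately show "g * x * e i i \<in> span T" by (simp add: span_scale Ts)
        qed
        finally have 3: "g * x * B.unity \<in> span T" .
        obtain c where "g * x * g = c *s g" using gscalar x by blast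
        moreover have "g \<in> T" by (simp add: T_def)
        ultimately have 4: "g * x * g \<in> span T" by (simp add: span_scale Ts)
        have "x = M.unity * x * M.unity" using x by simp
        also have "\<dots> = B.unity * x * B.unity + B.unity * x * g + g * x * B.unity + g * x * g"
          unfolding u by (simp add: algebra_simps)
        finally show ?thesis using 1 2 3 4 by (metis span_add)
      qed
      then have "I \<subseteq> span T" using IM by auto
      then have "card I \<le> card T"
        using independent_span_bound[OF T independent_mono[OF D(1) I(1)]] by blast
      then show ?thesis using I cardT by simp
    qed
  qed
qed

end

section \<open>Infinite products of unipotent conjugations\<close>

locale nilpotent_sequence = nonunital_algebra scale
  for scale :: "'f::field \<Rightarrow> 'a::ring \<Rightarrow> 'a" (infixr \<open>*s\<close> 75) +
  fixes z y :: "nat \<Rightarrow> 'a"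
  assumes square_zero: "z n * z n = 0"
    and z_commute: "z m * z n = z n * z m"
    and z_y_commute: "m \<noteq> n \<Longrightarrow> z m * y n = y n * z m"
    and z_y_not_commute: "z n * y n \<noteq> y n * z n"
    and z_eventually_commutes: "\<forall>\<^sub>F n in sequentially. z n * x = x * z n"
    and y_eventually_commutes: "\<forall>\<^sub>F n in sequentially. y n * x = x * y n"
begin

text \<open>
  This is \<open>(1 + t z\<^sub>n) x (1 - t z\<^sub>n)\<close> multiplied out, so that no unit has to be adjoined; the two
  outer factors are inverse to each other because \<open>z\<^sub>n\<^sup>2 = 0\<close>.
\<close>

definition unipotent_conj :: "nat \<Rightarrow> 'f \<Rightarrow> 'a \<Rightarrow> 'a" where
  "unipotent_conj n t x = x + t *s (z n * x - x * z n) - (t * t) *s (z n * x * z n)"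

lemma zz [simp]: "z n * z n = 0" "z n * (z n * x) = 0"
  by (simp_all add: square_zero flip: mult.assoc)

lemma unipotent_conj_add: "unipotent_conj n t (x + x') = unipotent_conj n t x + unipotent_conj n t x'"
  by (simp add: unipotent_conj_def algebra_simps scale_right_distrib)

lemma unipotent_conj_scale: "unipotent_conj n t (c *s x) = c *s unipotent_conj n t x"
  by (simp add: unipotent_conj_def scale_right_distrib scale_right_diff_distrib scale_mult_left scale_mult_right mult.commute)

lemma unipotent_conj_mult: "unipotent_conj n t (x * x') = unipotent_conj n t x * unipotent_conj n t x'"
  by (simp add: unipotent_conj_def algebra_simps scale_right_diff_distrib scale_right_distrib
      scale_mult_left scale_mult_right)

lemma unipotent_conj_zero [simp]: "unipotent_conj n 0 x = x"
  by (simp add: unipotent_conj_def)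

lemma unipotent_conj_plus: "unipotent_conj n (s + t) x = unipotent_conj n s (unipotent_conj n t x)"
  by (simp add: unipotent_conj_def algebra_simps scale_right_diff_distrib scale_right_distrib scale_left_distrib
      scale_mult_left scale_mult_right)
    (simp add: mult_2_right distrib_left flip: scale_left_distrib)

lemma unipotent_conj_fixes:
  assumes "z n * x = x * z n"
  shows "unipotent_conj n t x = x"
proof -
  have "z n * x * z n = 0" using assms by (simp add: mult.assoc)
  then show ?thesis using assms by (simp add: unipotent_conj_def)
qed

text \<open>
  Multiplying \<open>z x - x z = t z x z\<close> by \<open>z\<close> from the left leaves \<open>- z x z = 0\<close>.
\<close>

lemma unipotent_conj_moves:
  assumes "unipotent_conj n t x = x" "t \<noteq> 0"
  shows "z n * x = x * z n"
proof -
  have 0: "t *s (z n * x - x * z n) = (t * t) *s (z n * x * z n)"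
    using assms(1) by (simp add: unipotent_conj_def algebra_simps)
  then have "z n * (t *s (z n * x - x * z n)) = z n * ((t * t) *s (z n * x * z n))" by simp
  then have "z n * x * z n = 0"
    using assms(2) by (simp add: scale_mult_right right_diff_distrib mult.assoc)
  with 0 assms(2) show ?thesis by simp
qed

lemma unipotent_conj_commute: "unipotent_conj m s (unipotent_conj n t x) = unipotent_conj n t (unipotent_conj m s x)"
proof -
  \<comment> \<open>Left multiplication by \<open>1 + r z\<^sub>k\<close> and right multiplication by \<open>1 - r z\<^sub>k\<close> commute pairwise.\<close>
  define L R where "L k r v = v + r *s (z k * v)" and "R k r v = v - r *s (v * z k)" for k r v
  have LR: "unipotent_conj k r v = L k r (R k r v)" for k r v
    by (simp add: unipotent_conj_def L_def R_def algebra_simps scale_right_diff_distrib scale_mult_right)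
  have L: "L m s (L n t v) = L n t (L m s v)" for v
  proof -
    have "z m * (z n * v) = z n * (z m * v)" by (metis z_commute mult.assoc)
    then show ?thesis
      by (simp add: L_def algebra_simps scale_right_distrib scale_mult_right)
  qed
  have R: "R m s (R n t v) = R n t (R m s v)" for v
    by (simp add: R_def algebra_simps scale_right_diff_distrib scale_mult_left z_commute[of m n])
  have M: "R k r (L l q v) = L l q (R k r v)" for k l r q v
    by (simp add: L_def R_def algebra_simps scale_right_diff_distrib scale_right_distrib
        scale_mult_left scale_mult_right)
  show ?thesis unfolding LR M by (simp add: L R)
qed

text \<open>
  The factor with the largest index acts first, so factors that fix the argument can be dropped at
  the right end of the composition.
\<close>

primrec partial_conj :: "(nat \<Rightarrow> 'f) \<Rightarrow> nat \<Rightarrow> 'a \<Rightarrow> 'a" where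
  "partial_conj t 0 = (\<lambda>x. x)"
| "partial_conj t (Suc n) = (\<lambda>x. partial_conj t n (unipotent_conj n (t n) x))"

lemma partial_conj_add: "partial_conj t n (x + x') = partial_conj t n x + partial_conj t n x'"
  by (induction n arbitrary: x x') (simp_all add: unipotent_conj_add)

lemma partial_conj_scale: "partial_conj t n (c *s x) = c *s partial_conj t n x"
  by (induction n arbitrary: x) (simp_all add: unipotent_conj_scale)

lemma partial_conj_mult: "partial_conj t n (x * x') = partial_conj t n x * partial_conj t n x'"
  by (induction n arbitrary: x x') (simp_all add: unipotent_conj_mult)

lemma partial_conj_zero: "partial_conj (\<lambda>_. 0) n x = x"
  by (induction n) simp_all

lemma partial_conj_commute: "unipotent_conj m s (partial_conj t n x) = partial_conj t n (unipotent_conj m s x)"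
proof (induction n arbitrary: x)
  case (Suc n)
  then show ?case by (simp add: unipotent_conj_commute[of m s n "t n"])
qed simp

lemma partial_conj_plus: "partial_conj (\<lambda>i. s i + t i) n x = partial_conj s n (partial_conj t n x)"
proof (induction n arbitrary: x)
  case (Suc n)
  then show ?case by (simp only: partial_conj.simps unipotent_conj_plus partial_conj_commute)
qed simp

lemma partial_conj_fixes: "(\<And>i. i < n \<Longrightarrow> z i * x = x * z i) \<Longrightarrow> partial_conj t n x = x"
proof (induction n)
  case (Suc n)
  then have "unipotent_conj n (t n) x = x" by (intro unipotent_conj_fixes) auto
  with Suc show ?case by simp
qed simp

lemma partial_conj_stable:
  assumes "\<And>i. m \<le> i \<Longrightarrow> z i * x = x * z i" "m \<le> n"
  shows "partial_conj t n x = partial_conj t m x"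
  using assms(2)
proof (induction rule: dec_induct)
  case (step k)
  then have "unipotent_conj k (t k) x = x" by (intro unipotent_conj_fixes assms(1))
  with step show ?case by simp
qed simp

text \<open>
  The eventual value of \<open>partial_conj t n x\<close>, taken at the first index from which on all factors
  fix \<open>x\<close>.
\<close>

definition limit_conj :: "(nat \<Rightarrow> 'f) \<Rightarrow> 'a \<Rightarrow> 'a" where
  "limit_conj t x = partial_conj t (LEAST m. \<forall>i\<ge>m. z i * x = x * z i) x"

lemma limit_conj_eventually: "\<forall>\<^sub>F n in sequentially. limit_conj t x = partial_conj t n x"
proof -
  define m where "m = (LEAST m. \<forall>i\<ge>m. z i * x = x * z i)"
  have "\<exists>m. \<forall>i\<ge>m. z i * x = x * z i"
    using z_eventually_commutes[of x] unfolding eventually_sequentially .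
  then have m: "\<forall>i\<ge>m. z i * x = x * z i" unfolding m_def by (rule LeastI_ex)
  have "limit_conj t x = partial_conj t m x" by (simp only: limit_conj_def m_def)
  also have "\<dots> = partial_conj t n x" if "m \<le> n" for n
    using that m by (metis partial_conj_stable)
  finally show ?thesis by (rule eventually_sequentiallyI)
qed

lemma limit_conj_eqI:
  assumes "\<forall>\<^sub>F n in sequentially. partial_conj t n x = w"
  shows "limit_conj t x = w"
proof -
  have "\<forall>\<^sub>F n in sequentially. limit_conj t x = w"
    using limit_conj_eventually[of t x] assms by eventually_elim simp
  then show ?thesis by simp
qed

lemma limit_conj_add: "limit_conj t (x + x') = limit_conj t x + limit_conj t x'"
  by (rule limit_conj_eqI, use limit_conj_eventually[of t x] limit_conj_eventually[of t x'] in eventually_elim)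
    (simp add: partial_conj_add)

lemma limit_conj_scale: "limit_conj t (c *s x) = c *s limit_conj t x"
  by (rule limit_conj_eqI, use limit_conj_eventually[of t x] in eventually_elim)
    (simp add: partial_conj_scale)

lemma limit_conj_mult: "limit_conj t (x * x') = limit_conj t x * limit_conj t x'"
  by (rule limit_conj_eqI, use limit_conj_eventually[of t x] limit_conj_eventually[of t x'] in eventually_elim)
    (simp add: partial_conj_mult)

lemma limit_conj_zero: "limit_conj (\<lambda>_. 0) x = x"
  by (rule limit_conj_eqI) (simp add: partial_conj_zero)

lemma limit_conj_plus: "limit_conj (\<lambda>i. s i + t i) x = limit_conj s (limit_conj t x)"
  by (rule limit_conj_eqI,
      use limit_conj_eventually[of t x] limit_conj_eventually[of s "limit_conj t x"] in eventually_elim)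
    (simp add: partial_conj_plus)

text \<open>The product for \<open>- t\<close> is inverse to the product for \<open>t\<close>.\<close>

lemma limit_conj_in_Aut: "limit_conj t \<in> carrier Aut"
proof -
  have "limit_conj t (limit_conj (\<lambda>i. - t i) x) = x" "limit_conj (\<lambda>i. - t i) (limit_conj t x) = x" for x
    unfolding limit_conj_plus[symmetric] by (simp_all add: limit_conj_zero)
  then have "bij (limit_conj t)" by (intro o_bij[of "limit_conj (\<lambda>i. - t i)"]) auto
  then show ?thesis
    by (simp add: Aut_mem limit_conj_add limit_conj_scale limit_conj_mult)
qed

text \<open>All factors except the one with index \<open>n\<close> commute with \<open>y n\<close>, so only that one acts.\<close>

lemma limit_conj_y: "limit_conj t (y n) = unipotent_conj n (t n) (y n)"
proof (rule limit_conj_eqI)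
  let ?w = "unipotent_conj n (t n) (y n)"
  have "partial_conj t m (y n) = ?w" if "Suc n \<le> m" for m
  proof -
    have "partial_conj t m (y n) = partial_conj t (Suc n) (y n)"
      using that z_y_commute by (intro partial_conj_stable) auto
    also have "\<dots> = unipotent_conj n (t n) (partial_conj t n (y n))" by (simp add: partial_conj_commute)
    also have "partial_conj t n (y n) = y n" using z_y_commute by (intro partial_conj_fixes) auto
    finally show ?thesis .
  qed
  then show "\<forall>\<^sub>F m in sequentially. partial_conj t m (y n) = ?w"
    unfolding eventually_sequentially by blast
qed

text \<open>
  Conjugation by \<open>a + c\<cdot>1\<close> fixes the elements that commute with \<open>a\<close>, hence almost all \<open>y n\<close>.
\<close>

lemma limit_conj_inner:
  assumes "limit_conj t \<in> Inn"
  shows "\<forall>\<^sub>F n in sequentially. t n = 0"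
proof -
  obtain u v where uv: "u \<star> v = adj_one" "v \<star> u = adj_one" "\<And>x. (limit_conj t x, 0) = v \<star> (x, 0) \<star> u"
    using assms by (auto simp: Inn_adj)
  show ?thesis
    using y_eventually_commutes[of "fst u"]
  proof eventually_elim
    case (elim n)
    have "(y n, 0) \<star> u = u \<star> (y n, 0)" using elim by (simp add: adj_mult_def)
    then have "(limit_conj t (y n), 0::'f) = (y n, 0)"
      by (simp add: uv(2,3) adj_assoc adj_cancel)
    then have "unipotent_conj n (t n) (y n) = y n" by (simp add: limit_conj_y)
    then show "t n = 0" using unipotent_conj_moves z_y_not_commute by blast
  qed
qed

text \<open>
  By the homomorphism property the quotient of the two automorphisms is the product for \<open>s - t\<close>.
\<close>

lemma limit_conj_same_coset:
  assumes "Inn #>\<^bsub>Aut\<^esub> limit_conj s = Inn #>\<^bsub>Aut\<^esub> limit_conj t"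
  shows "\<forall>\<^sub>F n in sequentially. s n = t n"
proof -
  have "subgroup Inn Aut" using Inn_normal by (simp add: normal_def)
  then have "limit_conj s \<in> Inn #>\<^bsub>Aut\<^esub> limit_conj t"
    using assms group.rcos_self[OF group_Aut limit_conj_in_Aut] by metis
  then obtain h where h: "h \<in> Inn" "limit_conj s = h \<circ> limit_conj t"
    by (auto simp: r_coset_def)
  have "h x = limit_conj (\<lambda>i. s i - t i) x" for x
  proof -
    have "limit_conj (\<lambda>i. s i - t i) x = limit_conj s (limit_conj (\<lambda>i. - t i) x)"
      using limit_conj_plus[of s "\<lambda>i. - t i" x] by simp
    also have "\<dots> = h (limit_conj t (limit_conj (\<lambda>i. - t i) x))" using h by simp
    also have "\<dots> = h x" unfolding limit_conj_plus[symmetric] by (simp add: limit_conj_zero)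
    finally show ?thesis by simp
  qed
  then have "limit_conj (\<lambda>i. s i - t i) \<in> Inn" using h(1) by (metis ext)
  from limit_conj_inner[OF this] show ?thesis by simp
qed

lemma sequences_le_Out: "|UNIV :: (nat \<Rightarrow> 'f) set| \<le>o |carrier Out|"
proof -
  \<comment> \<open>Every entry of \<open>t\<close> occurs infinitely often in \<open>spread t\<close>, so an eventual equality between
    spread sequences forces equality of the original ones.\<close>
  define spread :: "(nat \<Rightarrow> 'f) \<Rightarrow> nat \<Rightarrow> 'f" where "spread t n = t (fst (prod_decode n))" for t n
  have "inj (\<lambda>t. Inn #>\<^bsub>Aut\<^esub> limit_conj (spread t))"
  proof (rule injI)
    fix s t :: "nat \<Rightarrow> 'f"
    assume "Inn #>\<^bsub>Aut\<^esub> limit_conj (spread s) = Inn #>\<^bsub>Aut\<^esub> limit_conj (spread t)"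
    then obtain N where N: "\<And>n. n \<ge> N \<Longrightarrow> spread s n = spread t n"
      using limit_conj_same_coset unfolding eventually_sequentially by metis
    have "s k = t k" for k
      using N[of "prod_encode (k, N)"] le_prod_encode_2[of N k] by (simp add: spread_def)
    then show "s = t" by blast
  qed
  moreover have "range (\<lambda>t. Inn #>\<^bsub>Aut\<^esub> limit_conj (spread t)) \<subseteq> carrier Out"
    using limit_conj_in_Aut by (auto simp: Out_def FactGroup_def RCOSETS_def)
  ultimately show ?thesis by (metis card_of_ordLeq)
qed

end

section \<open>Cardinalities\<close>

context nonunital_algebra
begin

lemma countable_basis:
  assumes "countable_dimensional"
  obtains b :: "nat \<Rightarrow> 'a" where "inj b" "independent (range b)" "span (range b) = UNIV"
proof -
  obtain D where D: "independent D" "span D = UNIV" "|D| =o natLeq"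
    using assms unfolding countable_dimensional_def by blast
  have "|D| =o |UNIV :: nat set|" using D(3) card_of_nat ordIso_symmetric ordIso_transitive by blast
  then obtain b :: "nat \<Rightarrow> 'a" where "bij_betw b UNIV D"
    using card_of_ordIso ordIso_symmetric by metis
  then show ?thesis using that D unfolding bij_betw_def by metis
qed

end

context locally_matrix_algebra
begin

text \<open>
  The chain of matrix subalgebras is built recursively: the next one contains the previous one, the
  pair found in its centralizer, and the next basis vector, so that the chain exhausts the algebra.
\<close>

lemma exists_nilpotent_sequence:
  assumes "countable_dimensional"
  obtains z y where "nilpotent_sequence scale z y"
proof -
  obtain b :: "nat \<Rightarrow> 'a" where b: "inj b" "independent (range b)" "span (range b) = UNIV"
    using countable_basis assms by blast
  then have "infinite (range b)" using finite_imageD infinite_UNIV_nat by blast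
  define matrix_alg where "matrix_alg S \<longleftrightarrow> (\<exists>d e. matrix_units scale d e \<and> matrix_units.alg scale d e = S)" for S
  define step where "step n S S' z y \<longleftrightarrow> S \<subseteq> S' \<and> b n \<in> S' \<and> z \<in> S' \<and> y \<in> S' \<and> z * z = 0 \<and> z * y \<noteq> y * z
      \<and> (\<forall>x\<in>S. z * x = x * z \<and> y * x = x * y)" for n S S' z y
  have extend: "\<exists>S'. matrix_alg S' \<and> (\<exists>z y. step n S S' z y)" if S: "matrix_alg S" for n S
  proof -
    obtain d e where mu: "matrix_units scale d e" "matrix_units.alg scale d e = S"
      using S by (auto simp: matrix_alg_def)
    then obtain z y where zy: "z * z = 0" "z * y \<noteq> y * z" "\<And>x. x \<in> S \<Longrightarrow> z * x = x * z \<and> y * x = x * y"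
      using centralizing_nilpotent[OF mu(1) b(2) \<open>infinite (range b)\<close>] by metis
    obtain n' E where mu': "matrix_units scale n' E"
        and sub: "{b n, z, y} \<union> case_prod e ` ({..<d} \<times> {..<d}) \<subseteq> matrix_units.alg scale n' E"
      using matrix_subalgebra_containing[of "{b n, z, y} \<union> case_prod e ` ({..<d} \<times> {..<d})"] by auto
    have "S \<subseteq> matrix_units.alg scale n' E"
      using sub matrix_units.subspace_alg[OF mu']
      unfolding mu(2)[symmetric] matrix_units.alg_def[OF mu(1)] by (intro span_minimal) auto
    then have "step n S (matrix_units.alg scale n' E) z y" using sub zy by (auto simp: step_def)
    then show ?thesis using mu' by (auto simp: matrix_alg_def)
  qed
  have start: "\<exists>S. matrix_alg S"
    unfolding matrix_alg_def by (metis finite.emptyI matrix_subalgebra_containing)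
  have "\<exists>S. \<forall>n. matrix_alg (S n) \<and> (\<exists>z y. step n (S n) (S (Suc n)) z y)"
    by (rule dependent_nat_choice) (use start extend in blast)+
  then obtain S where S: "\<And>n. matrix_alg (S n)" "\<And>n. \<exists>z y. step n (S n) (S (Suc n)) z y"
    by blast
  then obtain z y where zy: "\<And>n. step n (S n) (S (Suc n)) (z n) (y n)" by metis
  note zy = zy[unfolded step_def]
  have mono: "S m \<subseteq> S n" if "m \<le> n" for m n
    using that by (rule lift_Suc_mono_le[rotated]) (use zy in blast)
  have sub: "subspace (S n)" for n
    using S(1)[of n] matrix_units.subspace_alg unfolding matrix_alg_def by metis
  have mem: "z m \<in> S n" "y m \<in> S n" if "m < n" for m n
    using zy[of m] mono[of "Suc m" n] that by (simp_all only: Suc_le_eq) blast+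
  have comm: "z n * x = x * z n" "y n * x = x * y n" if "x \<in> S n" for x n
    using zy[of n] that by blast+
  have cover: "\<exists>m. x \<in> S m" for x
  proof -
    have "subspace (\<Union>m. S m)"
    proof (rule subspaceI)
      fix x y assume "x \<in> (\<Union>m. S m)" "y \<in> (\<Union>m. S m)"
      then obtain m n where "x \<in> S m" "y \<in> S n" by blast
      then have "x \<in> S (max m n)" "y \<in> S (max m n)"
        using mono[of m "max m n"] mono[of n "max m n"] by auto
      then show "x + y \<in> (\<Union>m. S m)" using subspace_add[OF sub] by blast
    qed (use sub subspace_0 subspace_scale in blast)+
    moreover have "range b \<subseteq> (\<Union>m. S m)" using zy by blast
    ultimately have "span (range b) \<subseteq> (\<Union>m. S m)" by (rule span_minimal[rotated])
    then show ?thesis using b(3) by blast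
  qed
  have "nilpotent_sequence scale z y"
  proof unfold_locales
    fix m n :: nat and x
    show "z n * z n = 0" "z n * y n \<noteq> y n * z n" using zy[of n] by blast+
    show "z m * z n = z n * z m" using comm mem by (metis linorder_neqE_nat)
    show "z m * y n = y n * z m" if "m \<noteq> n" using that comm mem by (metis linorder_neqE_nat)
    obtain k where "x \<in> S k" using cover by blast
    then have "x \<in> S n" if "k \<le> n" for n using mono that by blast
    then show "\<forall>\<^sub>F n in sequentially. z n * x = x * z n" "\<forall>\<^sub>F n in sequentially. y n * x = x * y n"
      unfolding eventually_sequentially using comm by blast+
  qed
  then show ?thesis using that by blast
qed

end

context nonunital_algebra
begin

lemma Out_le_Aut: "|carrier Out| \<le>o |carrier Aut|"
proof -
  have "carrier Out = (\<lambda>f. Inn #>\<^bsub>Aut\<^esub> f) ` carrier Aut"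
    by (auto simp: Out_def FactGroup_def RCOSETS_def)
  then show ?thesis by (metis card_of_image)
qed

lemma Aut_le_sequences:
  assumes "countable_dimensional"
  shows "|carrier Aut| \<le>o |UNIV :: (nat \<Rightarrow> 'f) set|"
proof -
  obtain b :: "nat \<Rightarrow> 'a" where b: "inj b" "independent (range b)" "span (range b) = UNIV"
    using countable_basis assms by blast
  define D where "D = range b"
  have D: "independent D" "span D = UNIV" using b by (auto simp: D_def)
  \<comment> \<open>The matrix of \<open>f\<close> in the basis \<open>b\<close>, flattened to a sequence.\<close>
  define entries where "entries f n = (case prod_decode n of (i, j) \<Rightarrow> representation D (f (b i)) (b j))"
    for f :: "'a \<Rightarrow> 'a" and n
  have "inj_on entries (carrier Aut)"
  proof (rule inj_onI)
    fix f g assume fg: "f \<in> carrier Aut" "g \<in> carrier Aut" "entries f = entries g"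
    have lin: "Vector_Spaces.linear scale scale f" "Vector_Spaces.linear scale scale g"
      using fg by (auto simp: Aut_def)
    have "f (b i) = g (b i)" for i
    proof -
      have "representation D (f (b i)) v = representation D (g (b i)) v" for v
      proof (cases "v \<in> D")
        case True
        then obtain j where "v = b j" unfolding D_def by blast
        then show ?thesis
          using fun_cong[OF fg(3), of "prod_encode (i, j)"] by (simp add: entries_def)
      next
        case False
        then show ?thesis using representation_ne_zero by metis
      qed
      then have "representation D (f (b i)) = representation D (g (b i))" by (rule ext)
      then show ?thesis using D by (metis UNIV_I sum_nonzero_representation_eq)
    qed
    then have eq: "f v = g v" if "v \<in> D" for v using that unfolding D_def by blast
    show "f = g"
    proof
      fix x
      show "f x = g x"
        using vector_space_pair.linear_eq_on_span[OF _ lin eq, of D x] D(2)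
        by (simp add: vector_space_pair_def vector_space_axioms)
    qed
  qed
  then show ?thesis by (metis card_of_ordLeq subset_UNIV)
qed

end

theorem theorem8:
  fixes scale :: "'f::field \<Rightarrow> 'a::ring \<Rightarrow> 'a"
  assumes "locally_matrix_algebra scale"
    and "nonunital_algebra.countable_dimensional scale"
  shows "|carrier (nonunital_algebra.Aut scale)| =o |carrier (nonunital_algebra.Out scale)| \<and>
         |carrier (nonunital_algebra.Out scale)| =o |UNIV :: 'f set| ^c natLeq"
proof -
  interpret locally_matrix_algebra scale by fact
  obtain z y where "nilpotent_sequence scale z y"
    using exists_nilpotent_sequence assms(2) by blast
  then have lower: "|UNIV :: (nat \<Rightarrow> 'f) set| \<le>o |carrier Out|"
    by (rule nilpotent_sequence.sequences_le_Out)
  have upper: "|carrier Aut| \<le>o |UNIV :: (nat \<Rightarrow> 'f) set|"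
    using Aut_le_sequences assms(2) by blast
  have "|UNIV :: 'f set| ^c natLeq = |UNIV :: (nat \<Rightarrow> 'f) set|"
    by (simp add: cexp_def Field_natLeq Field_card_of Func_def)
  moreover have "|carrier Aut| =o |carrier Out|"
    using Out_le_Aut lower upper ordIso_iff_ordLeq ordLeq_transitive by blast
  moreover have "|carrier Out| =o |UNIV :: (nat \<Rightarrow> 'f) set|"
    using Out_le_Aut lower upper ordIso_iff_ordLeq ordLeq_transitive by blast
  ultimately show ?thesis by metis
qed

end
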